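(* Let $G$ be a connected graph on $n$ vertices with chromatic number $\chi\le n-1$, let $b_\chi=n+\lceil n/\chi\rceil$, and let $\ell_1$ be the largest color-class size in a fixed proper coloring of $G$ with exactly $\chi$ color classes. Then $$\mu_G([b_\chi,\partial_1^L(G)])\ge\ell_1-1\ge\left\lceil\frac{n}{\chi}\right\rceil-1.$$ Moreover, if $\ell_1\ge 4$, then $\mu_G([b_\chi,\partial_1^L(G)])\ge 3$.
   Context: Graphs are finite, simple and undirected. For a connected graph $G$ with vertices $v_1,\dots,v_n$, let $d_G(u,v)$ be the length of a shortest $u$–$v$ path, $D(G)=(d_G(v_i,v_j))_{i,j}$ the distance matrix, and $\operatorname{Tr}_G(v)=\sum_{u\in V(G)}d_G(u,v)$ the transmission of $v$. The distance Laplacian matrix is $\mathcal{D}^{L}(G)=\operatorname{diag}(\operatorname{Tr}_G(v_1),\dots,\operatorname{Tr}_G(v_n))-D(G)$, a real symmetric positive semidefinite matrix with $\mathcal{D}^{L}(G)\mathbf 1=\mathbf 0$. Its eigenvalues, listed with multiplicity, are ordered $\partial^{L}_1(G)\ge\partial^{L}_2(G)\ge\cdots\ge\partial^{L}_n(G)=0$. For a real interval $I$, $\mu_G(I)$ is the number of eigenvalues of $\mathcal{D}^{L}(G)$ in $I$, counted with multiplicity. A proper coloring is a partition of $V(G)$ into nonempty independent sets (color classes); the chromatic number is the least number of classes. *)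

theory Defs
  imports
    "Graph_Theory.Arc_Walk"
    "Graph_Theory.Digraph_Component"
    "Jordan_Normal_Form.Char_Poly"
    "HOL-Library.Disjoint_Sets"
    "HOL-Library.Multiset"
    "HOL-Computational_Algebra.Polynomial"
begin

text \<open>
  Finite simple undirected graphs are the instances of the locale \<open>graph\<close> of the AFP entry
  \<open>Graph_Theory\<close>: finite symmetric digraphs without loops and parallel arcs. Connectedness in that
  entry includes that there is at least one vertex.
\<close>

text \<open>Meaningful only when some path from \<open>u\<close> to \<open>v\<close> exists, as in a connected graph.\<close>

definition graph_dist :: "('a, 'b) pre_digraph \<Rightarrow> 'a \<Rightarrow> 'a \<Rightarrow> nat" where
  "graph_dist G u v = (LEAST k. \<exists>p. pre_digraph.apath G u p v \<and> length p = k)"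

definition transmission :: "('a, 'b) pre_digraph \<Rightarrow> 'a \<Rightarrow> nat" where
  "transmission G v = (\<Sum>u\<in>verts G. graph_dist G u v)"

text \<open>
  The matrices depend on an enumeration \<open>vs\<close> of the vertices, i.e. a distinct list with
  \<open>set vs = verts G\<close>.
\<close>

definition distance_matrix :: "('a, 'b) pre_digraph \<Rightarrow> 'a list \<Rightarrow> real mat" where
  "distance_matrix G vs =
     mat (length vs) (length vs) (\<lambda>(i, j). real (graph_dist G (vs ! i) (vs ! j)))"

definition distance_laplacian :: "('a, 'b) pre_digraph \<Rightarrow> 'a list \<Rightarrow> real mat" where
  "distance_laplacian G vs =
     mat_diag (length vs) (\<lambda>i. real (transmission G (vs ! i))) - distance_matrix G vs"

text \<open>
  The eigenvalues in non-increasing order, each repeated according to its multiplicity as a root of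
  the characteristic polynomial. As the matrix is real symmetric, its real roots are all its
  eigenvalues.
\<close>

definition dl_eigenvalues :: "('a, 'b) pre_digraph \<Rightarrow> 'a list \<Rightarrow> real list" where
  "dl_eigenvalues G vs =
     rev (sorted_list_of_multiset (proots (char_poly (distance_laplacian G vs))))"

text \<open>The index \<open>i\<close> starts at 1, so \<open>dl_eigenvalue G vs 1\<close> is the largest eigenvalue.\<close>

definition dl_eigenvalue :: "('a, 'b) pre_digraph \<Rightarrow> 'a list \<Rightarrow> nat \<Rightarrow> real" where
  "dl_eigenvalue G vs i = dl_eigenvalues G vs ! (i - 1)"

definition dl_eigenvalue_count :: "('a, 'b) pre_digraph \<Rightarrow> 'a list \<Rightarrow> real set \<Rightarrow> nat" where
  "dl_eigenvalue_count G vs I = length (filter (\<lambda>x. x \<in> I) (dl_eigenvalues G vs))"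

definition independent_set :: "('a, 'b) pre_digraph \<Rightarrow> 'a set \<Rightarrow> bool" where
  "independent_set G S \<longleftrightarrow> S \<subseteq> verts G \<and> (\<forall>u\<in>S. \<forall>v\<in>S. \<not> u \<rightarrow>\<^bsub>G\<^esub> v)"

text \<open>\<open>partition_on\<close> requires the color classes to be nonempty.\<close>

definition proper_coloring :: "('a, 'b) pre_digraph \<Rightarrow> 'a set set \<Rightarrow> bool" where
  "proper_coloring G P \<longleftrightarrow> partition_on (verts G) P \<and> (\<forall>C\<in>P. independent_set G C)"

definition chromatic_number :: "('a, 'b) pre_digraph \<Rightarrow> nat" where
  "chromatic_number G = (LEAST k. \<exists>P. proper_coloring G P \<and> card P = k)"

end

theory Submission
  imports Defs
begin

text \<open>
  The distance Laplacian is the Laplacian of a complete graph whose edges are weighted by distances, so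
  its quadratic form is \<open>\<Sum> d(u, v) (x u - x v)\<^sup>2\<close> over all unordered pairs of vertices. All weights
  are at least 1, and two distinct vertices of an independent set \<open>S\<close> are at distance at least 2. If \<open>x\<close>
  vanishes outside \<open>S\<close> and its entries add up to 0, then the sum of \<open>(x u - x v)\<^sup>2\<close> is \<open>n |x|\<^sup>2\<close> over all
  pairs and \<open>card S * |x|\<^sup>2\<close> over the pairs inside \<open>S\<close>; so the form is at least \<open>(n + card S) |x|\<^sup>2\<close>
  (\<open>distance_laplacian_form_on_independent_set\<close>). Such vectors form a space of dimension \<open>card S - 1\<close>,
  and by the Courant--Fischer principle (\<open>eigenvalue_count_ge_of_quadratic_form_bound\<close>) at least that many
  eigenvalues are \<open>n + card S\<close> or larger.

  Take for \<open>S\<close> a largest color class. By averaging it has at least \<open>n / \<chi>\<close>, hence at least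
  \<open>\<lceil>n / \<chi>\<rceil>\<close> vertices (\<open>partition_largest_part\<close>), so \<open>b \<le> n + card S\<close> and the first two
  inequalities follow. The last claim is the first inequality for \<open>l1 \<ge> 4\<close>.

  The Courant--Fischer principle rests on the spectral theorem for real symmetric matrices
  (\<open>real_symmetric_orthogonally_diagonalizable\<close>), proved by splitting off one eigenvector at a time. Both
  proofs use that a homogeneous system with fewer equations than unknowns has a nonzero solution: to
  extend an eigenvector to an orthonormal basis, and to find a test vector orthogonal to given ones.
\<close>

section \<open>Underdetermined systems and orthonormal bases\<close>

text \<open>
  Padding the fewer than \<open>n\<close> equations with zero rows gives a square matrix; having a zero row,
  it is singular, so it has a nonzero kernel vector.
\<close>

lemma homogeneous_system_nonzero_solution:
  fixes ws :: "'a :: field vec list"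
  assumes "length ws < n" and "set ws \<subseteq> carrier_vec n"
  obtains x where "x \<in> carrier_vec n" "x \<noteq> 0\<^sub>v n" "\<And>w. w \<in> set ws \<Longrightarrow> w \<bullet> x = 0"
proof -
  define rs where "rs = ws @ replicate (n - length ws) (0\<^sub>v n)"
  have len: "length rs = n" using assms(1) by (simp add: rs_def)
  have rs: "set rs \<subseteq> carrier_vec n" using assms(2) by (auto simp: rs_def)
  define M where "M = mat_of_rows n rs"
  have M: "M \<in> carrier_mat n n" using mat_of_rows_carrier(1)[of n rs] len by (simp add: M_def)
  have row: "row M i = rs ! i" if "i < n" for i
  proof -
    have "rs ! i \<in> carrier_vec n" using that rs len by (metis nth_mem subsetD)
    thus ?thesis unfolding M_def using that len by (intro mat_of_rows_row) simp_all
  qed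
  have "rs ! (n - 1) = 0\<^sub>v n"
    using assms(1) by (auto simp: rs_def nth_append)
  hence row0: "row M (n - 1) = 0\<^sub>v n" using row[of "n - 1"] assms(1) by auto
  \<comment> \<open>The zero row of \<open>M\<close> is a zero column of its transpose, which therefore kills a unit vector.\<close>
  have "M\<^sup>T *\<^sub>v unit_vec n (n - 1) = 0\<^sub>v n"
  proof (rule eq_vecI)
    fix i assume "i < dim_vec (0\<^sub>v n :: 'a vec)"
    hence i: "i < n" by simp
    have "(M\<^sup>T *\<^sub>v unit_vec n (n - 1)) $ i = row M (n - 1) $ i"
      using i M assms(1) by simp
    also have "\<dots> = 0\<^sub>v n $ i" by (simp only: row0)
    finally show "(M\<^sup>T *\<^sub>v unit_vec n (n - 1)) $ i = 0\<^sub>v n $ i" .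
  qed (use M in auto)
  moreover have "unit_vec n (n - 1) \<noteq> (0\<^sub>v n :: 'a vec)"
    using assms(1) by (intro unit_vec_nonzero) auto
  moreover have "M\<^sup>T \<in> carrier_mat n n" using M by simp
  ultimately have "det M\<^sup>T = 0"
    using det_0_iff_vec_prod_zero_field unit_vec_carrier by blast
  hence "det M = 0" using det_transpose[OF M] by simp
  then obtain x where x: "x \<in> carrier_vec n" "x \<noteq> 0\<^sub>v n" "M *\<^sub>v x = 0\<^sub>v n"
    using det_0_iff_vec_prod_zero_field[OF M] by auto
  have "w \<bullet> x = 0" if "w \<in> set ws" for w
  proof -
    from that have "w \<in> set rs" by (auto simp: rs_def)
    then obtain i where i: "i < n" "rs ! i = w" using len by (auto simp: in_set_conv_nth)
    have "(M *\<^sub>v x) $ i = row M i \<bullet> x" using i M by auto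
    thus ?thesis using x(3) i row by auto
  qed
  with x show thesis using that by blast
qed

definition orthonormal :: "real vec list \<Rightarrow> bool" where
  "orthonormal us \<longleftrightarrow>
     (\<forall>i<length us. \<forall>j<length us. us ! i \<bullet> us ! j = (if i = j then 1 else 0))"

lemma scalar_prod_self_pos:
  fixes x :: "real vec"
  assumes "x \<in> carrier_vec n" "x \<noteq> 0\<^sub>v n"
  shows "x \<bullet> x > 0"
proof -
  have "conjugate x = x" by (auto intro: eq_vecI)
  thus ?thesis using conjugate_square_greater_0_vec[OF assms(1)] assms(2) by simp
qed

lemma orthonormal_snoc:
  assumes "x \<bullet> x = 1" "\<And>u. u \<in> set us \<Longrightarrow> x \<bullet> u = 0" "\<And>u. u \<in> set us \<Longrightarrow> u \<bullet> x = 0"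
    "orthonormal us"
  shows "orthonormal (us @ [x])"
  using assms by (auto simp: orthonormal_def nth_append less_Suc_eq)

lemma normalize_vec:
  fixes x :: "real vec"
  assumes "x \<in> carrier_vec n" "x \<noteq> 0\<^sub>v n"
  obtains y c where "y \<in> carrier_vec n" "y = c \<cdot>\<^sub>v x" "y \<bullet> y = 1"
proof -
  let ?c = "1 / sqrt (x \<bullet> x)"
  have p: "x \<bullet> x > 0" using scalar_prod_self_pos[OF assms] .
  have "(?c \<cdot>\<^sub>v x) \<bullet> (?c \<cdot>\<^sub>v x) = ?c * (?c * (x \<bullet> x))" using assms(1) by simp
  also have "\<dots> = 1" using p by (simp add: field_simps)
  finally show thesis using that[of "?c \<cdot>\<^sub>v x" ?c] assms(1) by auto
qed

text \<open>
  As long as there are fewer than \<open>n\<close> vectors, orthogonality to all of them is an underdetermined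
  homogeneous system; a nonzero solution, normalized, is the next basis vector.
\<close>

lemma orthonormal_basis_extension:
  assumes "set us \<subseteq> carrier_vec n" "orthonormal us" "length us \<le> n"
  obtains vs where "set (us @ vs) \<subseteq> carrier_vec n" "orthonormal (us @ vs)" "length (us @ vs) = n"
proof -
  have "\<exists>vs. set (us @ vs) \<subseteq> carrier_vec n \<and> orthonormal (us @ vs) \<and> length (us @ vs) = n"
    using assms
  proof (induction "n - length us" arbitrary: us)
    case 0
    then show ?case by (intro exI[of _ "[]"]) auto
  next
    case (Suc k)
    hence "length us < n" by simp
    from homogeneous_system_nonzero_solution[OF this Suc.prems(1)]
    obtain x where x: "x \<in> carrier_vec n" "x \<noteq> 0\<^sub>v n" and xu: "\<And>u. u \<in> set us \<Longrightarrow> u \<bullet> x = 0"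
      by blast
    obtain y c where y: "y \<in> carrier_vec n" "y = c \<cdot>\<^sub>v x" "y \<bullet> y = 1"
      using normalize_vec[OF x] .
    have 1: "u \<bullet> y = 0" if "u \<in> set us" for u
      using xu[OF that] x that Suc.prems(1) by (auto simp: y(2))
    have 2: "y \<bullet> u = 0" if "u \<in> set us" for u
      using 1[OF that] comm_scalar_prod[OF y(1), of u] that Suc.prems(1) by auto
    have "orthonormal (us @ [y])" using orthonormal_snoc[OF y(3) 2 1 Suc.prems(2)] by blast
    moreover have "set (us @ [y]) \<subseteq> carrier_vec n" "length (us @ [y]) \<le> n"
      "k = n - length (us @ [y])"
      using Suc.hyps(2) Suc.prems(1) y(1) by auto
    ultimately obtain vs where "set ((us @ [y]) @ vs) \<subseteq> carrier_vec n"
      "orthonormal ((us @ [y]) @ vs)" "length ((us @ [y]) @ vs) = n"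
      using Suc.hyps(1)[of "us @ [y]"] by blast
    thus ?case by (intro exI[of _ "y # vs"]) auto
  qed
  thus thesis using that by blast
qed

section \<open>The spectral theorem for real symmetric matrices\<close>

lemma symmetric_scalar_prod:
  assumes A: "A \<in> carrier_mat n n" and sym: "A\<^sup>T = A"
    and "x \<in> carrier_vec n" "y \<in> carrier_vec n"
  shows "x \<bullet> (A *\<^sub>v y) = (A *\<^sub>v x) \<bullet> (y :: 'a :: comm_ring_1 vec)"
  using transpose_vec_mult_scalar[OF A assms(4,3)] sym by simp

text \<open>
  Over the complex numbers there is an eigenvector \<open>x + \<i> y\<close> with some eigenvalue \<open>a\<close>.
  Comparing \<open>x \<bullet> A y\<close> with \<open>A x \<bullet> y\<close>, which agree by symmetry, gives \<open>Im a * (|x|\<^sup>2 + |y|\<^sup>2) = 0\<close>.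
  So \<open>a\<close> is real, both \<open>x\<close> and \<open>y\<close> satisfy the eigenvector equation, and one of them is nonzero.
\<close>

lemma real_symmetric_has_eigenvector:
  fixes A :: "real mat"
  assumes A: "A \<in> carrier_mat n n" and sym: "A\<^sup>T = A" and n: "n \<noteq> 0"
  obtains x e where "x \<in> carrier_vec n" "x \<noteq> 0\<^sub>v n" "A *\<^sub>v x = e \<cdot>\<^sub>v x"
proof -
  let ?C = "map_mat complex_of_real A"
  have C: "?C \<in> carrier_mat n n" using A by simp
  obtain as where as: "char_poly ?C = (\<Prod>a\<leftarrow>as. [:- a, 1:])" "length as = n"
    using char_poly_factorized[OF C] by blast
  with n obtain a bs where "as = a # bs" by (cases as) auto
  hence "poly (char_poly ?C) a = 0" using as by simp
  hence "eigenvalue ?C a" using eigenvalue_root_char_poly[OF C] by simp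
  then obtain v where v: "v \<in> carrier_vec n" "v \<noteq> 0\<^sub>v n" "?C *\<^sub>v v = a \<cdot>\<^sub>v v"
    using A unfolding eigenvalue_def eigenvector_def by auto
  define x where "x = map_vec Re v"
  define y where "y = map_vec Im v"
  have x: "x \<in> carrier_vec n" and y: "y \<in> carrier_vec n" using v by (auto simp: x_def y_def)
  have Cv: "(\<Sum>j<n. of_real (A $$ (i,j)) * v $ j) = a * v $ i" if "i < n" for i
  proof -
    have "(?C *\<^sub>v v) $ i = (\<Sum>j<n. of_real (A $$ (i,j)) * v $ j)"
      using that A v(1) by (auto simp: scalar_prod_def lessThan_atLeast0 intro!: sum.cong)
    thus ?thesis using v that by simp
  qed
  have Ax: "A *\<^sub>v x = Re a \<cdot>\<^sub>v x - Im a \<cdot>\<^sub>v y"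
  proof (rule eq_vecI)
    fix i assume "i < dim_vec (Re a \<cdot>\<^sub>v x - Im a \<cdot>\<^sub>v y)"
    hence i: "i < n" using y by simp
    have "(A *\<^sub>v x) $ i = (\<Sum>j<n. A $$ (i,j) * Re (v $ j))"
      using i A v(1) by (auto simp: x_def scalar_prod_def lessThan_atLeast0 intro!: sum.cong)
    also have "\<dots> = Re (a * v $ i)" by (simp add: Cv[OF i, symmetric])
    finally show "(A *\<^sub>v x) $ i = (Re a \<cdot>\<^sub>v x - Im a \<cdot>\<^sub>v y) $ i"
      using i v(1) by (simp add: x_def y_def)
  qed (use A y in auto)
  have Ay: "A *\<^sub>v y = Re a \<cdot>\<^sub>v y + Im a \<cdot>\<^sub>v x"
  proof (rule eq_vecI)
    fix i assume "i < dim_vec (Re a \<cdot>\<^sub>v y + Im a \<cdot>\<^sub>v x)"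
    hence i: "i < n" using x by simp
    have "(A *\<^sub>v y) $ i = (\<Sum>j<n. A $$ (i,j) * Im (v $ j))"
      using i A v(1) by (auto simp: y_def scalar_prod_def lessThan_atLeast0 intro!: sum.cong)
    also have "\<dots> = Im (a * v $ i)" by (simp add: Cv[OF i, symmetric])
    finally show "(A *\<^sub>v y) $ i = (Re a \<cdot>\<^sub>v y + Im a \<cdot>\<^sub>v x) $ i"
      using i v(1) by (simp add: x_def y_def)
  qed (use A x in auto)
  have nz: "x \<noteq> 0\<^sub>v n \<or> y \<noteq> 0\<^sub>v n"
  proof (rule ccontr)
    assume "\<not> ?thesis"
    hence 0: "x = 0\<^sub>v n" "y = 0\<^sub>v n" by auto
    have "v $ i = 0" if "i < n" for i
    proof -
      have "x $ i = 0" "y $ i = 0" using that unfolding 0 by auto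
      thus ?thesis using that v(1) by (simp add: x_def y_def complex_eq_iff)
    qed
    hence "v = 0\<^sub>v n" using v(1) by (intro eq_vecI) auto
    thus False using v by simp
  qed
  have xx: "x \<bullet> x \<ge> 0" "y \<bullet> y \<ge> 0" by (auto simp: scalar_prod_def intro!: sum_nonneg)
  have pos: "x \<bullet> x + y \<bullet> y > 0"
    using nz scalar_prod_self_pos[OF x] scalar_prod_self_pos[OF y] xx by auto
  have "x \<bullet> (A *\<^sub>v y) = (A *\<^sub>v x) \<bullet> y" using symmetric_scalar_prod[OF A sym x y] .
  hence "Re a * (x \<bullet> y) + Im a * (x \<bullet> x) = Re a * (x \<bullet> y) - Im a * (y \<bullet> y)"
    unfolding Ax Ay using x y
    by (simp add: scalar_prod_add_distrib[of _ n] minus_scalar_prod_distrib[of _ n])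
  hence "Im a * (x \<bullet> x + y \<bullet> y) = 0" by (simp add: algebra_simps)
  hence im: "Im a = 0" using pos by simp
  have "A *\<^sub>v x = Re a \<cdot>\<^sub>v x" "A *\<^sub>v y = Re a \<cdot>\<^sub>v y" unfolding Ax Ay im using x y by auto
  thus thesis using nz that x y by blast
qed

lemma orthogonal_triple_product_entry:
  fixes A :: "'a :: comm_ring_1 mat"
  assumes A: "A \<in> carrier_mat n n" and U: "U \<in> carrier_mat n m" and "i < m" "j < m"
  shows "(U\<^sup>T * A * U) $$ (i, j) = col U i \<bullet> (A *\<^sub>v col U j)"
proof -
  have "U\<^sup>T * A * U = U\<^sup>T * (A * U)" using A U by (intro assoc_mult_mat) auto
  also have "\<dots> $$ (i, j) = col U i \<bullet> col (A * U) j" using assms by simp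
  also have "col (A * U) j = A *\<^sub>v col U j" using assms by (intro col_mult2) auto
  finally show ?thesis .
qed

text \<open>
  The spectral theorem, by deflation. In an orthonormal basis that starts with a unit eigenvector the
  first column of the matrix is \<open>(e, 0, \<dots>, 0)\<close>; by symmetry so is the first row. The remaining block
  is again symmetric, and the induction hypothesis diagonalizes it.
\<close>

lemma real_symmetric_orthogonally_diagonalizable:
  fixes A :: "real mat"
  assumes "A \<in> carrier_mat n n" and "A\<^sup>T = A"
  obtains P f where "P \<in> carrier_mat n n" "P\<^sup>T * P = 1\<^sub>m n" "P\<^sup>T * A * P = mat_diag n f"
proof -
  have "\<exists>P f. P \<in> carrier_mat n n \<and> P\<^sup>T * P = 1\<^sub>m n \<and> P\<^sup>T * A * P = mat_diag n f"
    using assms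
  proof (induction n arbitrary: A)
    case 0
    then show ?case by (intro exI[of _ "1\<^sub>m 0"] exI[of _ "\<lambda>_. 0"]) (auto intro!: eq_matI simp: mat_diag_def)
  next
    case (Suc n)
    note A = Suc.prems(1) and sym = Suc.prems(2)
    obtain x e where x: "x \<in> carrier_vec (Suc n)" "x \<noteq> 0\<^sub>v (Suc n)" "A *\<^sub>v x = e \<cdot>\<^sub>v x"
      using real_symmetric_has_eigenvector[OF A sym] by blast
    obtain v c where v: "v \<in> carrier_vec (Suc n)" "v = c \<cdot>\<^sub>v x" "v \<bullet> v = 1"
      using normalize_vec[OF x(1,2)] .
    have Av: "A *\<^sub>v v = e \<cdot>\<^sub>v v"
      using mult_mat_vec[OF A x(1), of c] x(1,3) by (simp add: v(2) smult_smult_assoc mult.commute)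
    have "orthonormal [v]" using v(3) by (simp add: orthonormal_def)
    from orthonormal_basis_extension[OF _ this, of "Suc n"] v(1)
    obtain us where us: "set (v # us) \<subseteq> carrier_vec (Suc n)" "orthonormal (v # us)"
      "length (v # us) = Suc n" by auto
    define U where "U = mat_of_cols (Suc n) (v # us)"
    have U: "U \<in> carrier_mat (Suc n) (Suc n)"
      using us(3) mat_of_cols_carrier(1)[of "Suc n" "v # us"] by (simp add: U_def del: mat_of_cols_carrier)
    have colU: "col U i = (v # us) ! i" if "i < Suc n" for i
      unfolding U_def using that us by (intro col_mat_of_cols) (auto simp del: nth_Cons_Suc, metis nth_mem subsetD us(1) us(3))
    have col0: "col U 0 = v" using colU[of 0] by simp
    have colc: "col U i \<in> carrier_vec (Suc n)" for i
      by (rule carrier_vecI) (use U in simp)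
    have UU: "U\<^sup>T * U = 1\<^sub>m (Suc n)"
    proof (rule eq_matI)
      fix i j assume "i < dim_row (1\<^sub>m (Suc n) :: real mat)" "j < dim_col (1\<^sub>m (Suc n) :: real mat)"
      hence ij: "i < Suc n" "j < Suc n" by auto
      have "(U\<^sup>T * U) $$ (i, j) = col U i \<bullet> col U j" using U ij by simp
      also have "\<dots> = (if i = j then 1 else 0)"
        using us(2,3) ij by (simp add: colU orthonormal_def del: nth_Cons_Suc)
      finally show "(U\<^sup>T * U) $$ (i, j) = 1\<^sub>m (Suc n) $$ (i, j)" using ij by simp
    qed (use U in auto)
    define B where "B = U\<^sup>T * A * U"
    have B: "B \<in> carrier_mat (Suc n) (Suc n)" using A U by (simp add: B_def)
    have Bij: "B $$ (i, j) = col U i \<bullet> (A *\<^sub>v col U j)" if "i < Suc n" "j < Suc n" for i j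
      unfolding B_def using orthogonal_triple_product_entry[OF A U that] .
    have Bsym: "B $$ (i, j) = B $$ (j, i)" if "i < Suc n" "j < Suc n" for i j
    proof -
      have "col U i \<bullet> (A *\<^sub>v col U j) = (A *\<^sub>v col U i) \<bullet> col U j"
        by (rule symmetric_scalar_prod[OF A sym colc colc])
      also have "\<dots> = col U j \<bullet> (A *\<^sub>v col U i)" using A colc
        by (intro comm_scalar_prod[of _ "Suc n"]) auto
      finally show ?thesis using that by (simp add: Bij)
    qed
    have B0: "B $$ (i, 0) = (if i = 0 then e else 0)" if "i < Suc n" for i
    proof -
      have "B $$ (i, 0) = e * (col U i \<bullet> col U 0)"
        using Bij[OF that, of 0] v(1) U by (simp add: col0 Av)
      also have "col U i \<bullet> col U 0 = (if i = 0 then 1 else 0)"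
        using us(2,3) that by (simp add: colU orthonormal_def del: nth_Cons_Suc nth_Cons_0)
      finally show ?thesis by simp
    qed
    define B' where "B' = mat n n (\<lambda>(i, j). B $$ (Suc i, Suc j))"
    have B': "B' \<in> carrier_mat n n" by (simp add: B'_def)
    have "B'\<^sup>T = B'" by (rule eq_matI) (auto simp: B'_def Bsym)
    from Suc.IH[OF B' this] obtain P f where P: "P \<in> carrier_mat n n" "P\<^sup>T * P = 1\<^sub>m n"
      "P\<^sup>T * B' * P = mat_diag n f" by blast
    let ?E = "mat 1 1 (\<lambda>_. e)"
    have Bblock: "B = four_block_mat ?E (0\<^sub>m 1 n) (0\<^sub>m n 1) B'"
    proof (rule eq_matI)
      fix i j assume "i < dim_row (four_block_mat ?E (0\<^sub>m 1 n) (0\<^sub>m n 1) B')"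
        "j < dim_col (four_block_mat ?E (0\<^sub>m 1 n) (0\<^sub>m n 1) B')"
      hence "i < Suc n" "j < Suc n" using B' by auto
      thus "B $$ (i, j) = four_block_mat ?E (0\<^sub>m 1 n) (0\<^sub>m n 1) B' $$ (i, j)"
        using B' B0 Bsym[of 0 j] by (cases i; cases j) (auto simp: B'_def)
    qed (use B B' in auto)
    define Q where "Q = four_block_mat (1\<^sub>m 1) (0\<^sub>m 1 n) (0\<^sub>m n 1) P"
    have Q: "Q \<in> carrier_mat (Suc n) (Suc n)"
      using four_block_carrier_mat[OF one_carrier_mat P(1), of 1] by (simp add: Q_def)
    have QT: "Q\<^sup>T = four_block_mat (1\<^sub>m 1) (0\<^sub>m 1 n) (0\<^sub>m n 1) P\<^sup>T"
      unfolding Q_def by (subst transpose_four_block_mat[of _ 1 1 _ n _ n]) (use P in auto)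
    have QQ: "Q\<^sup>T * Q = 1\<^sub>m (Suc n)"
      unfolding QT unfolding Q_def using P
      by (subst mult_four_block_mat[of _ 1 1 _ n _ n _ _ 1 _ n]) (auto simp: P(2) intro!: eq_matI)
    have QBQ: "Q\<^sup>T * B * Q = four_block_mat ?E (0\<^sub>m 1 n) (0\<^sub>m n 1) (mat_diag n f)"
      unfolding QT Bblock unfolding Q_def using P(1) B'
      apply (subst mult_four_block_mat[of _ 1 1 _ n _ n _ _ 1 _ n], auto)[1]
      apply (subst mult_four_block_mat[of _ 1 1 _ n _ n _ _ 1 _ n], auto)[1]
      by (simp add: P(3)[symmetric] assoc_mult_mat[of _ n n _ n _ n])
    also have "\<dots> = mat_diag (Suc n) (case_nat e f)"
      by (rule eq_matI) (auto simp: mat_diag_def split: nat.split)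
    finally have QBQ': "Q\<^sup>T * B * Q = mat_diag (Suc n) (case_nat e f)" .
    have T: "(U * Q)\<^sup>T = Q\<^sup>T * U\<^sup>T" using U Q by (rule transpose_mult)
    have c: "U\<^sup>T \<in> carrier_mat (Suc n) (Suc n)" "Q\<^sup>T \<in> carrier_mat (Suc n) (Suc n)" using U Q by auto
    have 1: "(U * Q)\<^sup>T * (U * Q) = 1\<^sub>m (Suc n)"
    proof -
      have "(U * Q)\<^sup>T * (U * Q) = Q\<^sup>T * (U\<^sup>T * (U * Q))" unfolding T
        using c U Q by (intro assoc_mult_mat) auto
      also have "U\<^sup>T * (U * Q) = (U\<^sup>T * U) * Q" using c U Q by (intro assoc_mult_mat[symmetric]) auto
      finally show ?thesis using Q QQ by (simp add: UU)
    qed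
    have 2: "(U * Q)\<^sup>T * A * (U * Q) = mat_diag (Suc n) (case_nat e f)"
    proof -
      have "(U * Q)\<^sup>T * A * (U * Q) = Q\<^sup>T * (U\<^sup>T * A * U) * Q"
        unfolding T using c U Q A
        by (smt (verit, ccfv_threshold) assoc_mult_mat mult_carrier_mat)
      thus ?thesis using QBQ' by (simp add: B_def)
    qed
    show ?case using 1 2 mult_carrier_mat[OF U Q] by blast
  qed
  thus thesis using that by blast
qed

section \<open>Counting eigenvalues with the quadratic form\<close>

lemma proots_prod_linear_factors:
  "proots (\<Prod>a\<leftarrow>as. [:- a, 1:]) = mset (as :: 'a :: idom list)"
proof (induction as)
  case (Cons a as)
  have "(\<Prod>a\<leftarrow>as. [:- a, 1:]) \<noteq> (0 :: 'a poly)" by (auto simp: prod_list_zero_iff)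
  with Cons show ?case by (simp add: proots_mult del: mult_pCons_left)
qed simp

lemma scalar_prod_mat_diag:
  fixes y :: "'a :: comm_semiring_1 vec"
  assumes "y \<in> carrier_vec n"
  shows "y \<bullet> (mat_diag n f *\<^sub>v y) = (\<Sum>i<n. f i * (y $ i * y $ i))"
proof -
  have "(mat_diag n f *\<^sub>v y) $ i = f i * y $ i" if "i < n" for i
  proof -
    have "(mat_diag n f *\<^sub>v y) $ i = (\<Sum>j = 0..<n. (if i = j then f j else 0) * y $ j)"
      using that assms by (simp add: scalar_prod_def mat_diag_def)
    also have "\<dots> = (\<Sum>j = 0..<n. if i = j then f j * y $ j else 0)"
      by (intro sum.cong) auto
    finally show ?thesis using that by simp
  qed
  thus ?thesis using assms
    by (auto simp: scalar_prod_def mat_diag_def lessThan_atLeast0 ac_simps intro!: sum.cong)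
qed

text \<open>
  One half of the Courant--Fischer principle: if the quadratic form is at least \<open>c |x|\<^sup>2\<close> on the
  solution space of \<open>m\<close> homogeneous equations, then at least \<open>n - m\<close> eigenvalues are at least \<open>c\<close>.
  With fewer such eigenvalues, one could require in addition that \<open>x\<close> be orthogonal to all of their
  eigenvectors and still find \<open>x \<noteq> 0\<close>. This \<open>x\<close> would be a combination of eigenvectors for eigenvalues
  below \<open>c\<close>, so its form value would be strictly smaller than \<open>c |x|\<^sup>2\<close>.
\<close>

theorem eigenvalue_count_ge_of_quadratic_form_bound:
  fixes A :: "real mat"
  assumes A: "A \<in> carrier_mat n n" and sym: "A\<^sup>T = A" and ws: "set ws \<subseteq> carrier_vec n"
    and bound: "\<And>x. \<lbrakk>x \<in> carrier_vec n; \<And>w. w \<in> set ws \<Longrightarrow> w \<bullet> x = 0\<rbrakk>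
                  \<Longrightarrow> c * (x \<bullet> x) \<le> x \<bullet> (A *\<^sub>v x)"
  shows "n \<le> size (filter_mset (\<lambda>e. c \<le> e) (proots (char_poly A))) + length ws"
proof -
  obtain P f where P: "P \<in> carrier_mat n n" and PP: "P\<^sup>T * P = 1\<^sub>m n"
    and D: "P\<^sup>T * A * P = mat_diag n f"
    using real_symmetric_orthogonally_diagonalizable[OF A sym] .
  have PT: "P\<^sup>T \<in> carrier_mat n n" using P by simp
  have PP': "P * P\<^sup>T = 1\<^sub>m n" using mat_mult_left_right_inverse[OF PT P PP] .
  let ?D = "mat_diag n f"
  have AD: "A = P * ?D * P\<^sup>T"
  proof -
    have "P * ?D * P\<^sup>T = P * (P\<^sup>T * (A * P)) * P\<^sup>T"
      unfolding D[symmetric] using P PT A by (simp add: assoc_mult_mat[of _ n n _ n _ n])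
    also have "P * (P\<^sup>T * (A * P)) = (P * P\<^sup>T) * (A * P)"
      using P PT A by (intro assoc_mult_mat[symmetric]) auto
    also have "\<dots> = A * P" using P A by (simp add: PP')
    also have "A * P * P\<^sup>T = A * (P * P\<^sup>T)" using P PT A by (intro assoc_mult_mat) auto
    finally show ?thesis using A by (simp add: PP')
  qed
  have "similar_mat A ?D"
    using P PT A PP PP' AD by (intro similar_matI[of _ _ P "P\<^sup>T" n]) auto
  hence "char_poly A = char_poly ?D" by (rule char_poly_similar)
  also have "\<dots> = (\<Prod>a\<leftarrow>diag_mat ?D. [:- a, 1:])"
    by (rule char_poly_upper_triangular[of _ n]) (auto simp: mat_diag_def)
  also have "diag_mat ?D = map f [0..<n]" by (auto simp: diag_mat_def mat_diag_def)
  finally have roots: "proots (char_poly A) = mset (map f [0..<n])"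
    by (simp only: proots_prod_linear_factors)
  define K where "K = filter (\<lambda>i. c \<le> f i) [0..<n]"
  have size: "size (filter_mset (\<lambda>e. c \<le> e) (proots (char_poly A))) = length K"
    unfolding roots K_def mset_filter[symmetric] size_mset filter_map by (simp add: o_def)
  show ?thesis
  proof (rule ccontr)
    assume "\<not> ?thesis"
    hence "length (ws @ map (col P) K) < n" by (simp add: size)
    moreover have "set (ws @ map (col P) K) \<subseteq> carrier_vec n" using ws P by auto
    ultimately obtain x where x: "x \<in> carrier_vec n" "x \<noteq> 0\<^sub>v n"
      and orth: "\<And>w. w \<in> set (ws @ map (col P) K) \<Longrightarrow> w \<bullet> x = 0"
      using homogeneous_system_nonzero_solution by blast
    \<comment> \<open>The coordinates of \<open>x\<close> in the orthonormal eigenbasis.\<close>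
    define y where "y = P\<^sup>T *\<^sub>v x"
    have y: "y \<in> carrier_vec n" using PT x by (simp add: y_def)
    have yK: "y $ i = 0" if "i < n" "c \<le> f i" for i
      using orth[of "col P i"] that P by (auto simp: y_def K_def)
    have "x = (P * P\<^sup>T) *\<^sub>v x" using x by (simp add: PP')
    also have "\<dots> = P *\<^sub>v y" unfolding y_def using P PT x by (intro assoc_mult_mat_vec) auto
    finally have xy: "x = P *\<^sub>v y" .
    have ynz: "y \<noteq> 0\<^sub>v n"
    proof
      assume "y = 0\<^sub>v n"
      hence "x = 0\<^sub>v n" using xy P by (auto intro!: eq_vecI)
      thus False using x by simp
    qed
    have move: "x \<bullet> (P *\<^sub>v z) = y \<bullet> z" if "z \<in> carrier_vec n" for z
      using transpose_vec_mult_scalar[OF P that x(1)] by (simp add: y_def)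
    have xx: "x \<bullet> x = (\<Sum>i<n. y $ i * y $ i)"
      using move[OF y] xy y by (simp add: scalar_prod_def lessThan_atLeast0)
    have "A *\<^sub>v x = P *\<^sub>v (?D *\<^sub>v y)"
      unfolding y_def using x P PT
      by (subst AD) (simp add: assoc_mult_mat_vec[of _ n n _ n])
    hence "x \<bullet> (A *\<^sub>v x) = y \<bullet> (?D *\<^sub>v y)"
      using move[of "?D *\<^sub>v y"] y mult_mat_vec_carrier[OF mat_diag_dim y] by simp
    also have "\<dots> = (\<Sum>i<n. f i * (y $ i * y $ i))" by (rule scalar_prod_mat_diag[OF y])
    also have "\<dots> < (\<Sum>i<n. c * (y $ i * y $ i))"
    proof (rule sum_strict_mono_ex1)
      show "\<forall>i\<in>{..<n}. f i * (y $ i * y $ i) \<le> c * (y $ i * y $ i)"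
      proof
        fix i assume "i \<in> {..<n}"
        thus "f i * (y $ i * y $ i) \<le> c * (y $ i * y $ i)"
          using yK[of i] by (cases "c \<le> f i") (auto intro!: mult_right_mono)
      qed
      obtain i where i: "i < n" "y $ i \<noteq> 0"
        using ynz y by (metis carrier_vecD eq_vecI index_zero_vec)
      hence "f i < c" using yK[of i] by linarith
      hence "f i * (y $ i * y $ i) < c * (y $ i * y $ i)"
        using i(2) not_real_square_gt_zero by (intro mult_strict_right_mono) blast+
      thus "\<exists>i\<in>{..<n}. f i * (y $ i * y $ i) < c * (y $ i * y $ i)" using i by blast
    qed simp
    also have "\<dots> = c * (x \<bullet> x)" by (simp add: xx sum_distrib_left)
    finally show False using bound[OF x(1)] orth by fastforce
  qed
qed

section \<open>Quadratic forms of weighted Laplacians\<close>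

lemma sum_squared_differences:
  fixes x :: "'i \<Rightarrow> 'a :: comm_ring_1"
  shows "(\<Sum>i\<in>T. \<Sum>j\<in>T. (x i - x j)\<^sup>2) = 2 * of_nat (card T) * (\<Sum>i\<in>T. (x i)\<^sup>2) - 2 * (\<Sum>i\<in>T. x i)\<^sup>2"
proof -
  have "(\<Sum>i\<in>T. \<Sum>j\<in>T. (x i - x j)\<^sup>2)
      = (\<Sum>i\<in>T. \<Sum>j\<in>T. (x i)\<^sup>2) + (\<Sum>i\<in>T. \<Sum>j\<in>T. (x j)\<^sup>2) - (\<Sum>i\<in>T. \<Sum>j\<in>T. 2 * (x i * x j))"
    by (simp only: sum.distrib[symmetric] sum_subtractf[symmetric])
       (simp add: power2_eq_square algebra_simps)
  also have "(\<Sum>i\<in>T. \<Sum>j\<in>T. 2 * (x i * x j)) = 2 * (\<Sum>i\<in>T. x i)\<^sup>2"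
    unfolding power2_eq_square sum_product by (simp only: sum_distrib_left)
  also have "(\<Sum>i\<in>T. \<Sum>j\<in>T. (x i)\<^sup>2) = of_nat (card T) * (\<Sum>i\<in>T. (x i)\<^sup>2)"
    by (simp add: sum_distrib_left)
  finally show ?thesis by simp
qed

text \<open>
  The matrix is the Laplacian of the complete graph with edge weights \<open>W\<close>. The factor 2 appears because
  the double sum counts every unordered pair twice. Symmetry of \<open>W\<close> lets half of the terms be
  transposed, which completes the square.
\<close>

lemma laplacian_quadratic_form:
  fixes W :: "nat \<Rightarrow> nat \<Rightarrow> real"
  assumes sym: "\<And>i j. \<lbrakk>i < n; j < n\<rbrakk> \<Longrightarrow> W i j = W j i" and x: "x \<in> carrier_vec n"
    and L: "L = mat n n (\<lambda>(i, j). (if i = j then \<Sum>k<n. W i k else 0) - W i j)"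
  shows "2 * (x \<bullet> (L *\<^sub>v x)) = (\<Sum>i<n. \<Sum>j<n. W i j * (x $ i - x $ j)\<^sup>2)"
proof -
  have Lx: "(L *\<^sub>v x) $ i = (\<Sum>j<n. W i j * (x $ i - x $ j))" if "i < n" for i
  proof -
    have "(L *\<^sub>v x) $ i = (\<Sum>j<n. ((if i = j then \<Sum>k<n. W i k else 0) - W i j) * x $ j)"
      using that x by (simp add: L scalar_prod_def lessThan_atLeast0)
    also have "\<dots> = (\<Sum>j<n. if i = j then (\<Sum>k<n. W i k) * x $ j else 0) - (\<Sum>j<n. W i j * x $ j)"
      by (simp only: sum_subtractf[symmetric]) (auto intro!: sum.cong simp: algebra_simps)
    also have "\<dots> = (\<Sum>k<n. W i k) * x $ i - (\<Sum>j<n. W i j * x $ j)" using that by simp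
    finally show ?thesis by (simp add: sum_distrib_left sum_subtractf algebra_simps)
  qed
  let ?q = "\<lambda>i j. W i j * (x $ i - x $ j) * x $ i"
  have "x \<bullet> (L *\<^sub>v x) = (\<Sum>i<n. x $ i * (\<Sum>j<n. W i j * (x $ i - x $ j)))"
    using Lx by (auto simp: scalar_prod_def L lessThan_atLeast0 intro!: sum.cong)
  also have "\<dots> = (\<Sum>i<n. \<Sum>j<n. ?q i j)" by (simp add: sum_distrib_left mult_ac)
  finally have 1: "x \<bullet> (L *\<^sub>v x) = (\<Sum>i<n. \<Sum>j<n. ?q i j)" .
  also have "\<dots> = (\<Sum>i<n. \<Sum>j<n. ?q j i)" by (rule sum.swap)
  finally have "2 * (x \<bullet> (L *\<^sub>v x)) = (\<Sum>i<n. \<Sum>j<n. ?q i j + ?q j i)"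
    using 1 by (simp add: sum.distrib)
  also have "\<dots> = (\<Sum>i<n. \<Sum>j<n. W i j * (x $ i - x $ j)\<^sup>2)"
  proof (intro sum.cong refl)
    fix i j assume "i \<in> {..<n}" "j \<in> {..<n}"
    hence "W j i = W i j" using sym by simp
    thus "?q i j + ?q j i = W i j * (x $ i - x $ j)\<^sup>2" by (simp add: power2_eq_square algebra_simps)
  qed
  finally show ?thesis .
qed

section \<open>Distances in symmetric digraphs\<close>

text \<open>
  Walks are lists of arcs, so reversing a walk means replacing every arc by an arc in the opposite
  direction. Tracking the vertex sequence carries both length and distinctness over to the reversal.
\<close>

lemma (in sym_digraph) awalk_reverse:
  assumes "awalk u p v"
  shows "\<exists>q. awalk v q u \<and> awalk_verts v q = rev (awalk_verts u p)"
  using assms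
proof (induction p arbitrary: u)
  case Nil
  thus ?case by (intro exI[of _ "[]"]) (auto simp: awalk_Nil_iff)
next
  case (Cons e p)
  hence e: "e \<in> arcs G" "u = tail G e" and "awalk (head G e) p v" by (auto simp: awalk_Cons_iff)
  with Cons.IH obtain q where q: "awalk v q (head G e)"
    "awalk_verts v q = rev (awalk_verts (head G e) p)" by blast
  obtain e' where e': "e' \<in> arcs G" "tail G e' = head G e" "head G e' = tail G e"
    using sym_arcs e(1) unfolding symmetric_conv by metis
  have "awalk (head G e) [e'] u"
    using arc_implies_awalk[OF e'(1)] by (simp add: e' e(2))
  hence w: "awalk v (q @ [e']) u" using q(1) awalk_appendI by blast
  have "awalk_verts v (q @ [e']) = rev (awalk_verts u (e # p))"
    using awalk_verts_append[OF w] by (simp add: q(2) e' e(2))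
  with w show ?case by blast
qed

lemma (in sym_digraph) apath_reverse:
  assumes "apath u p v"
  obtains q where "apath v q u" "length q = length p"
proof -
  obtain q where q: "awalk v q u" "awalk_verts v q = rev (awalk_verts u p)"
    using awalk_reverse assms unfolding apath_def by blast
  have "Suc (length q) = Suc (length p)"
    using arg_cong[OF q(2), of length] by (simp add: length_awalk_verts)
  moreover have "apath v q u" using q assms by (simp add: apath_def)
  ultimately show thesis using that by simp
qed

lemma (in sym_digraph) graph_dist_commute: "graph_dist G u v = graph_dist G v u"
proof -
  have "(\<exists>p. apath u p v \<and> length p = k) \<longleftrightarrow> (\<exists>p. apath v p u \<and> length p = k)" for k
    by (metis apath_reverse)
  thus ?thesis by (simp add: graph_dist_def)
qed

lemma (in wf_digraph) graph_dist_shortest_apath: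
  assumes "u \<rightarrow>\<^sup>* v"
  obtains p where "apath u p v" "length p = graph_dist G u v"
proof -
  have "\<exists>k p. apath u p v \<and> length p = k" using assms reachable_apath by auto
  from LeastI_ex[OF this] that show thesis unfolding graph_dist_def by blast
qed

lemma (in wf_digraph) graph_dist_ge_1:
  assumes "u \<rightarrow>\<^sup>* v" "u \<noteq> v"
  shows "graph_dist G u v \<ge> 1"
proof -
  obtain p where p: "apath u p v" "length p = graph_dist G u v"
    using graph_dist_shortest_apath[OF assms(1)] .
  have "p \<noteq> []" using p(1) assms(2) by (auto simp: apath_Nil_iff)
  thus ?thesis using p(2) by (cases p) auto
qed

lemma (in wf_digraph) graph_dist_ge_2:
  assumes "u \<rightarrow>\<^sup>* v" "u \<noteq> v" "\<not> u \<rightarrow> v"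
  shows "graph_dist G u v \<ge> 2"
proof -
  obtain p where p: "apath u p v" "length p = graph_dist G u v"
    using graph_dist_shortest_apath[OF assms(1)] .
  have "p \<noteq> [e]" for e
    using p(1) assms(3) by (auto simp: apath_def awalk_simps arc_to_ends_def intro: dominatesI)
  moreover have "p \<noteq> []" using p(1) assms(2) by (auto simp: apath_Nil_iff)
  ultimately show ?thesis using p(2) by (cases p rule: remdups_adj.cases) auto
qed

section \<open>The distance Laplacian on independent sets\<close>

lemma sum_vertex_enumeration:
  assumes "distinct vs" "set vs = V"
  shows "(\<Sum>i<length vs. g (vs ! i)) = (\<Sum>v\<in>V. g v)"
  using sum.reindex_bij_betw[OF bij_betw_nth[OF assms(1) refl refl]] assms(2) by simp

text \<open>
  Brings the distance Laplacian into the shape of a weighted Laplacian. The transmission sums over the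
  first argument of the distance and the row sum over the second; they agree because the distance is
  symmetric.
\<close>

lemma (in sym_digraph) distance_laplacian_entries:
  assumes "distinct vs" "set vs = verts G"
  defines "W \<equiv> \<lambda>i j. real (graph_dist G (vs ! i) (vs ! j))"
  shows "distance_laplacian G vs
       = mat (length vs) (length vs) (\<lambda>(i, j). (if i = j then \<Sum>k<length vs. W i k else 0) - W i j)"
proof -
  have "real (transmission G v) = (\<Sum>k<length vs. real (graph_dist G v (vs ! k)))" for v
    using sum_vertex_enumeration[OF assms(1,2), of "\<lambda>u. real (graph_dist G v u)"]
    by (simp add: transmission_def graph_dist_commute[of _ v])
  thus ?thesis
    by (intro eq_matI) (auto simp: distance_laplacian_def distance_matrix_def mat_diag_def W_def)
qed

lemma (in sym_digraph) distance_laplacian_symmetric: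
  assumes "distinct vs" "set vs = verts G"
  shows "(distance_laplacian G vs)\<^sup>T = distance_laplacian G vs"
  unfolding distance_laplacian_entries[OF assms]
  by (rule eq_matI) (auto simp: graph_dist_commute)

text \<open>
  This is where the bound comes from. Every pair of distinct vertices has distance at least 1, and two
  distinct vertices of \<open>S\<close> have distance at least 2. Hence the form dominates that of the complete graph on all
  vertices plus that of the complete graph on \<open>S\<close>. On vectors with sum 0 supported on \<open>S\<close> these two
  equal \<open>n |x|\<^sup>2\<close> and \<open>card S * |x|\<^sup>2\<close>.
\<close>

lemma (in sym_digraph) distance_laplacian_form_on_independent_set:
  assumes sc: "strongly_connected G" and vs: "distinct vs" "set vs = verts G"
    and S: "independent_set G S" and n: "n = length vs" and x: "x \<in> carrier_vec n"
    and supp: "\<And>i. \<lbrakk>i < n; vs ! i \<notin> S\<rbrakk> \<Longrightarrow> x $ i = 0" and sum0: "(\<Sum>i<n. x $ i) = 0"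
  shows "real (n + card S) * (x \<bullet> x) \<le> x \<bullet> (distance_laplacian G vs *\<^sub>v x)"
proof -
  define I where "I = {i. i < n \<and> vs ! i \<in> S}"
  let ?d = "\<lambda>i j. real (graph_dist G (vs ! i) (vs ! j))"
  let ?s = "\<lambda>i. if i \<in> I then 1 else 0 :: real"
  let ?sq = "\<lambda>i j. (x $ i - x $ j)\<^sup>2"
  have I: "I \<subseteq> {..<n}" by (auto simp: I_def)
  have "bij_betw ((!) vs) {..<n} (verts G)" using bij_betw_nth[OF vs(1) refl refl] vs(2) n by simp
  hence "bij_betw ((!) vs) I S"
  proof (rule bij_betw_subset[OF _ I])
    show "(!) vs ` I = S"
      using S vs(2) unfolding independent_set_def I_def n
      by (auto simp: in_set_conv_nth subset_iff) (metis imageI in_set_conv_nth mem_Collect_eq)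
  qed
  hence cardI: "card I = card S" by (rule bij_betw_same_card)
  have supp': "x $ i = 0" if "i \<in> {..<n} - I" for i using supp that by (auto simp: I_def)
  have sumI: "(\<Sum>i\<in>I. x $ i) = 0"
    using sum.mono_neutral_right[OF _ I, of "\<lambda>i. x $ i"] supp' sum0 by simp
  have sqI: "(\<Sum>i\<in>I. (x $ i)\<^sup>2) = (\<Sum>i<n. (x $ i)\<^sup>2)"
    using sum.mono_neutral_right[OF _ I, of "\<lambda>i. (x $ i)\<^sup>2"] supp' by simp
  have xx: "x \<bullet> x = (\<Sum>i<n. (x $ i)\<^sup>2)"
    using x by (simp add: scalar_prod_def lessThan_atLeast0 power2_eq_square)
  have dist: "1 + ?s i * ?s j \<le> ?d i j" if "i < n" "j < n" "i \<noteq> j" for i j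
  proof -
    have uv: "vs ! i \<in> verts G" "vs ! j \<in> verts G" using that n vs(2) nth_mem by blast+
    have ne: "vs ! i \<noteq> vs ! j" using that n vs(1) by (simp add: nth_eq_iff_index_eq)
    have r: "vs ! i \<rightarrow>\<^sup>* vs ! j" using sc uv by auto
    have "?d i j \<ge> 2" if "i \<in> I" "j \<in> I"
    proof -
      have "\<not> vs ! i \<rightarrow> vs ! j" using S that by (auto simp: independent_set_def I_def)
      from graph_dist_ge_2[OF r ne this] show ?thesis by simp
    qed
    moreover have "?d i j \<ge> 1" using graph_dist_ge_1[OF r ne] by simp
    ultimately show ?thesis by auto
  qed
  have "(\<Sum>i<n. \<Sum>j<n. ?s i * ?s j * ?sq i j) = (\<Sum>i<n. ?s i * (\<Sum>j<n. ?s j * ?sq i j))"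
    by (simp add: sum_distrib_left mult_ac)
  also have "\<dots> = (\<Sum>i\<in>I. \<Sum>j\<in>I. ?sq i j)"
  proof -
    have *: "(\<Sum>i<n. ?s i * g i) = (\<Sum>i\<in>I. g i)" for g :: "nat \<Rightarrow> real"
      using sum.mono_neutral_right[OF _ I, of "\<lambda>i. ?s i * g i"] by simp
    show ?thesis by (simp only: *)
  qed
  finally have onI: "(\<Sum>i<n. \<Sum>j<n. ?s i * ?s j * ?sq i j) = (\<Sum>i\<in>I. \<Sum>j\<in>I. ?sq i j)" .
  have "2 * (real (n + card S) * (x \<bullet> x)) = (\<Sum>i<n. \<Sum>j<n. ?sq i j) + (\<Sum>i\<in>I. \<Sum>j\<in>I. ?sq i j)"
    unfolding sum_squared_differences by (simp add: sum0 sumI sqI xx cardI algebra_simps)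
  also have "\<dots> = (\<Sum>i<n. \<Sum>j<n. (1 + ?s i * ?s j) * ?sq i j)"
    by (simp only: onI[symmetric] sum.distrib[symmetric] distrib_right mult_1_left)
  also have "\<dots> \<le> (\<Sum>i<n. \<Sum>j<n. ?d i j * ?sq i j)"
  proof (intro sum_mono)
    fix i j assume "i \<in> {..<n}" "j \<in> {..<n}"
    thus "(1 + ?s i * ?s j) * ?sq i j \<le> ?d i j * ?sq i j"
      using dist[of i j] by (cases "i = j") (simp, intro mult_right_mono, simp_all)
  qed
  also have "\<dots> = 2 * (x \<bullet> (distance_laplacian G vs *\<^sub>v x))"
    using laplacian_quadratic_form[of n ?d x, OF _ x distance_laplacian_entries[OF vs, folded n]]
    by (simp add: graph_dist_commute)
  finally show ?thesis by simp
qed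

section \<open>Eigenvalue counts from independent sets and colorings\<close>

text \<open>
  The eigenvalues are listed in non-increasing order, so the upper end of the interval excludes none.
\<close>

lemma dl_eigenvalue_count_up_to_largest:
  "dl_eigenvalue_count G vs {c..dl_eigenvalue G vs 1}
     = size (filter_mset (\<lambda>e. c \<le> e) (proots (char_poly (distance_laplacian G vs))))"
proof -
  let ?es = "dl_eigenvalues G vs"
  have ms: "mset ?es = proots (char_poly (distance_laplacian G vs))" by (simp add: dl_eigenvalues_def)
  have "sorted (rev ?es)" by (simp add: dl_eigenvalues_def)
  hence "e \<le> ?es ! 0" if "e \<in> set ?es" for e
    using that by (cases ?es) (auto simp: sorted_append)
  hence "dl_eigenvalue_count G vs {c..dl_eigenvalue G vs 1} = length (filter (\<lambda>e. c \<le> e) ?es)"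
    unfolding dl_eigenvalue_count_def dl_eigenvalue_def by (auto intro!: arg_cong[of _ _ length] filter_cong)
  thus ?thesis by (simp flip: ms mset_filter)
qed

text \<open>
  Vanishing outside \<open>S\<close> takes \<open>n - card S\<close> equations and having sum 0 takes one more, which leaves
  \<open>card S - 1\<close> dimensions for the eigenvalue count.
\<close>

theorem (in sym_digraph) independent_set_dl_eigenvalue_count:
  assumes sc: "strongly_connected G" and vs: "distinct vs" "set vs = verts G"
    and S: "independent_set G S" and c: "c \<le> real (length vs + card S)"
  shows "card S \<le> dl_eigenvalue_count G vs {c..dl_eigenvalue G vs 1} + 1"
proof -
  define n where "n = length vs"
  define zs where "zs = filter (\<lambda>i. vs ! i \<notin> S) [0..<n]"
  define ws where "ws = vec n (\<lambda>_. 1 :: real) # map (unit_vec n) zs"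
  let ?L = "distance_laplacian G vs"
  have L: "?L \<in> carrier_mat n n" by (simp add: distance_laplacian_entries[OF vs] n_def)
  have ws: "set ws \<subseteq> carrier_vec n" by (auto simp: ws_def)
  have "n \<le> size (filter_mset (\<lambda>e. c \<le> e) (proots (char_poly ?L))) + length ws"
  proof (rule eigenvalue_count_ge_of_quadratic_form_bound[OF L distance_laplacian_symmetric[OF vs] ws])
    fix x :: "real vec" assume x: "x \<in> carrier_vec n" and orth: "\<And>w. w \<in> set ws \<Longrightarrow> w \<bullet> x = 0"
    have "x $ i = 0" if "i < n" "vs ! i \<notin> S" for i
      using orth[of "unit_vec n i"] that x by (simp add: ws_def zs_def)
    moreover have "(\<Sum>i<n. x $ i) = 0"
      using orth[of "vec n (\<lambda>_. 1)"] x by (simp add: ws_def scalar_prod_def lessThan_atLeast0)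
    ultimately have "real (n + card S) * (x \<bullet> x) \<le> x \<bullet> (?L *\<^sub>v x)"
      using distance_laplacian_form_on_independent_set[OF sc vs S n_def x] by blast
    moreover have "c * (x \<bullet> x) \<le> real (n + card S) * (x \<bullet> x)"
      using c by (intro mult_right_mono) (auto simp: n_def scalar_prod_def intro!: sum_nonneg)
    ultimately show "c * (x \<bullet> x) \<le> x \<bullet> (?L *\<^sub>v x)" by linarith
  qed
  moreover have "length zs + card S = n"
  proof -
    have "length zs = length (filter (\<lambda>v. v \<notin> S) vs)"
      unfolding zs_def n_def by (subst (2) map_nth[symmetric]) (simp add: filter_map o_def)
    moreover have "card S = length (filter (\<lambda>v. v \<in> S) vs)"
      using vs S distinct_card[of "filter (\<lambda>v. v \<in> S) vs"]
      by (simp add: independent_set_def) (metis Int_def inf.absorb_iff2 inf_commute)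
    ultimately show ?thesis using sum_length_filter_compl[of "\<lambda>v. v \<in> S" vs] by (simp add: n_def)
  qed
  ultimately show ?thesis unfolding dl_eigenvalue_count_up_to_largest by (simp add: ws_def)
qed

text \<open>
  The parts cover \<open>V\<close>, and none exceeds the largest one, so \<open>card V \<le> card P * Max (card ` P)\<close>;
  the size of the largest part is an integer, which allows rounding up.
\<close>

lemma partition_largest_part:
  assumes "finite V" "V \<noteq> {}" "partition_on V P"
  shows "\<lceil>real (card V) / real (card P)\<rceil> \<le> int (Max (card ` P))"
proof -
  have fin: "finite P" using assms(1,3) finite_elements by blast
  have ne: "P \<noteq> {}" using assms(2,3) by (auto simp: partition_on_def)
  have "card V = (\<Sum>C\<in>P. card C)"
    using card_Union_disjoint[of P] assms(1,3) finite_subset[of _ V]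
    by (auto simp: partition_on_def disjoint_def pairwise_def disjnt_def)
  also have "\<dots> \<le> card P * Max (card ` P)"
    using sum_bounded_above[of P card "Max (card ` P)"] fin by simp
  finally have "real (card V) \<le> real (Max (card ` P)) * real (card P)"
    by (metis mult.commute of_nat_le_iff of_nat_mult)
  thus ?thesis using fin ne by (simp add: ceiling_le_iff divide_le_eq card_gt_0_iff)
qed

theorem corollary3p4:
  fixes G :: "('a, 'b) pre_digraph"
    and vs :: "'a list"
    and n \<chi> l1 :: nat
    and b :: real
    and P :: "'a set set"
  assumes "Digraph.graph G"
    and "Digraph_Component.connected G"
    and "distinct vs" and "set vs = verts G"
    and "n = card (verts G)"
    and "\<chi> = chromatic_number G"
    and "\<chi> \<le> n - 1"
    and "b = real n + real_of_int \<lceil>real n / real \<chi>\<rceil>"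
    and "proper_coloring G P" and "card P = \<chi>"
    and "l1 = Max (card ` P)"
  shows "int (dl_eigenvalue_count G vs {b .. dl_eigenvalue G vs 1}) \<ge> int l1 - 1
       \<and> int l1 - 1 \<ge> \<lceil>real n / real \<chi>\<rceil> - 1
       \<and> (l1 \<ge> 4 \<longrightarrow> dl_eigenvalue_count G vs {b .. dl_eigenvalue G vs 1} \<ge> 3)"
proof -
  interpret graph G by fact
  have sc: "strongly_connected G"
    using symmetric_connected_imp_strongly_connected sym_arcs assms(2) by blast
  hence V: "verts G \<noteq> {}" by (simp add: strongly_connected_def)
  have part: "partition_on (verts G) P" and ind: "\<And>C. C \<in> P \<Longrightarrow> independent_set G C"
    using assms(9) by (auto simp: proper_coloring_def)
  have ceil: "\<lceil>real n / real \<chi>\<rceil> \<le> int l1"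
    using partition_largest_part[OF finite_verts V part] assms(5,10,11) by simp
  have "finite P" using finite_elements[OF finite_verts part] .
  moreover have "P \<noteq> {}" using V part by (auto simp: partition_on_def)
  ultimately have "l1 \<in> card ` P" unfolding assms(11) by (intro Max_in) auto
  then obtain C where C: "C \<in> P" "card C = l1" by blast
  have "length vs = n" using assms(3-5) distinct_card by metis
  hence "b \<le> real (length vs + card C)" using ceil by (simp add: assms(8) C(2))
  from independent_set_dl_eigenvalue_count[OF sc assms(3,4) ind[OF C(1)] this]
  have "l1 \<le> dl_eigenvalue_count G vs {b .. dl_eigenvalue G vs 1} + 1" by (simp add: C(2))
  thus ?thesis using ceil by auto
qed

end
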